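(* For every set $\Phi\cup\{\varphi\}\subseteq Fm_e$: $\Phi\vdash_{IEL}\varphi$ if and only if $\square\Phi\vdash_{EL5^*}\square\varphi$, where $\square\Phi:=\{\square\psi:\psi\in\Phi\}$.
   Context: Formulas $Fm$ are built from an infinite set of variables using $\bot,\wedge,\vee,\rightarrow$ and unary $\square,K$; $Fm_e\subseteq Fm$ is the set of formulas not containing $\square$. $\neg\varphi:=\varphi\rightarrow\bot$. $IEL$ is the system over $Fm_e$ with axiom schemes: all theorems of intuitionistic propositional logic and their substitution-instances (in $Fm_e$); $K(\varphi\rightarrow\psi)\rightarrow(K\varphi\rightarrow K\psi)$; $\varphi\rightarrow K\varphi$; $K\varphi\rightarrow\neg\neg\varphi$; with Modus Ponens as only rule; $\Phi\vdash_{IEL}\varphi$ is derivability from premises $\Phi$ in the usual sense. $EL5^*$ is the system over $Fm$ with axiom schemes: (INT) all theorems of intuitionistic propositional logic and their substitution-instances in $Fm$; $\square(\varphi\vee\psi)\rightarrow(\square\varphi\vee\square\psi)$; $\square\varphi\rightarrow\varphi$; $\square(\varphi\rightarrow\psi)\rightarrow\square(\square\varphi\rightarrow\square\psi)$; $\square\varphi\rightarrow\square\square\varphi$; $\neg\square\varphi\rightarrow\square\neg\square\varphi$; $\varphi\rightarrow K\varphi$; $K\varphi\rightarrow\neg\neg\varphi$; $K(\varphi\rightarrow\psi)\rightarrow(K\varphi\rightarrow K\psi)$; theorem scheme (TND) $\varphi\vee\neg\varphi$; rules Modus Ponens and Axiom Necessitation (if $\varphi$ is an axiom of $EL5^*$,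 infer $\square\varphi$; not applicable to instances of (TND) or other theorems). $\Phi\vdash_{EL5^*}\varphi$ means there is a finite sequence ending in $\varphi$ whose members are axioms, members of $\Phi$, instances of (TND), formulas $\square\psi$ with $\psi$ an axiom, or obtained by Modus Ponens from earlier members. *)

theory Defs
  imports Main
begin

datatype 'v fm =
    Var 'v
  | Bot ("\<^bold>\<bottom>")
  | And "'v fm" "'v fm" (infixr "\<^bold>\<and>" 65)
  | Or "'v fm" "'v fm" (infixr "\<^bold>\<or>" 63)
  | Imp "'v fm" "'v fm" (infixr "\<^bold>\<rightarrow>" 61)
  | Box "'v fm" ("\<^bold>\<box> _" [70] 70)
  | Know "'v fm" ("\<^bold>K _" [70] 70)

abbreviation Neg :: "'v fm \<Rightarrow> 'v fm" ("\<^bold>\<not> _" [70] 70) where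
  "\<^bold>\<not> \<phi> \<equiv> \<phi> \<^bold>\<rightarrow> \<^bold>\<bottom>"

primrec box_free :: "'v fm \<Rightarrow> bool" where
  "box_free (Var x) \<longleftrightarrow> True"
| "box_free \<^bold>\<bottom> \<longleftrightarrow> True"
| "box_free (\<phi> \<^bold>\<and> \<psi>) \<longleftrightarrow> box_free \<phi> \<and> box_free \<psi>"
| "box_free (\<phi> \<^bold>\<or> \<psi>) \<longleftrightarrow> box_free \<phi> \<and> box_free \<psi>"
| "box_free (\<phi> \<^bold>\<rightarrow> \<psi>) \<longleftrightarrow> box_free \<phi> \<and> box_free \<psi>"
| "box_free (\<^bold>\<box> \<phi>) \<longleftrightarrow> False"
| "box_free (\<^bold>K \<phi>) \<longleftrightarrow> box_free \<phi>"

primrec know_free :: "'v fm \<Rightarrow> bool" where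
  "know_free (Var x) \<longleftrightarrow> True"
| "know_free \<^bold>\<bottom> \<longleftrightarrow> True"
| "know_free (\<phi> \<^bold>\<and> \<psi>) \<longleftrightarrow> know_free \<phi> \<and> know_free \<psi>"
| "know_free (\<phi> \<^bold>\<or> \<psi>) \<longleftrightarrow> know_free \<phi> \<and> know_free \<psi>"
| "know_free (\<phi> \<^bold>\<rightarrow> \<psi>) \<longleftrightarrow> know_free \<phi> \<and> know_free \<psi>"
| "know_free (\<^bold>\<box> \<phi>) \<longleftrightarrow> know_free \<phi>"
| "know_free (\<^bold>K \<phi>) \<longleftrightarrow> False"

definition Fm_e :: "'v fm set" where
  "Fm_e = {\<phi>. box_free \<phi>}"

definition Fm_prop :: "'v fm set" where
  "Fm_prop = {\<phi>. box_free \<phi> \<and> know_free \<phi>}"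

primrec subst :: "('v \<Rightarrow> 'v fm) \<Rightarrow> 'v fm \<Rightarrow> 'v fm" where
  "subst \<sigma> (Var x) = \<sigma> x"
| "subst \<sigma> \<^bold>\<bottom> = \<^bold>\<bottom>"
| "subst \<sigma> (\<phi> \<^bold>\<and> \<psi>) = subst \<sigma> \<phi> \<^bold>\<and> subst \<sigma> \<psi>"
| "subst \<sigma> (\<phi> \<^bold>\<or> \<psi>) = subst \<sigma> \<phi> \<^bold>\<or> subst \<sigma> \<psi>"
| "subst \<sigma> (\<phi> \<^bold>\<rightarrow> \<psi>) = subst \<sigma> \<phi> \<^bold>\<rightarrow> subst \<sigma> \<psi>"
| "subst \<sigma> (\<^bold>\<box> \<phi>) = \<^bold>\<box> (subst \<sigma> \<phi>)"
| "subst \<sigma> (\<^bold>K \<phi>) = \<^bold>K (subst \<sigma> \<phi>)"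

text \<open>In \<open>derivation A ds\<close>, the set \<open>A\<close> collects everything that may be written down without
  appeal to earlier members of the sequence: axioms, premises, and so on.\<close>

definition derivation :: "'v fm set \<Rightarrow> 'v fm list \<Rightarrow> bool" where
  "derivation A ds \<longleftrightarrow>
     (\<forall>i<length ds. ds ! i \<in> A \<or> (\<exists>j<i. \<exists>k<i. ds ! k = (ds ! j \<^bold>\<rightarrow> ds ! i)))"

definition MP_derivable :: "'v fm set \<Rightarrow> 'v fm \<Rightarrow> bool" where
  "MP_derivable A \<phi> \<longleftrightarrow> (\<exists>ds. ds \<noteq> [] \<and> derivation A ds \<and> last ds = \<phi>)"

inductive_set ipc_schemes :: "'v fm set" where
  "\<phi> \<^bold>\<rightarrow> (\<psi> \<^bold>\<rightarrow> \<phi>) \<in> ipc_schemes"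
| "(\<phi> \<^bold>\<rightarrow> (\<psi> \<^bold>\<rightarrow> \<chi>)) \<^bold>\<rightarrow> ((\<phi> \<^bold>\<rightarrow> \<psi>) \<^bold>\<rightarrow> (\<phi> \<^bold>\<rightarrow> \<chi>)) \<in> ipc_schemes"
| "\<phi> \<^bold>\<rightarrow> (\<psi> \<^bold>\<rightarrow> (\<phi> \<^bold>\<and> \<psi>)) \<in> ipc_schemes"
| "(\<phi> \<^bold>\<and> \<psi>) \<^bold>\<rightarrow> \<phi> \<in> ipc_schemes"
| "(\<phi> \<^bold>\<and> \<psi>) \<^bold>\<rightarrow> \<psi> \<in> ipc_schemes"
| "\<phi> \<^bold>\<rightarrow> (\<phi> \<^bold>\<or> \<psi>) \<in> ipc_schemes"
| "\<psi> \<^bold>\<rightarrow> (\<phi> \<^bold>\<or> \<psi>) \<in> ipc_schemes"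
| "(\<phi> \<^bold>\<rightarrow> \<chi>) \<^bold>\<rightarrow> ((\<psi> \<^bold>\<rightarrow> \<chi>) \<^bold>\<rightarrow> ((\<phi> \<^bold>\<or> \<psi>) \<^bold>\<rightarrow> \<chi>)) \<in> ipc_schemes"
| "\<^bold>\<bottom> \<^bold>\<rightarrow> \<phi> \<in> ipc_schemes"

text \<open>Intuitionistic propositional logic proper lives in the purely propositional language;
  formulas with \<open>\<box>\<close> or \<open>K\<close> enter only through substitution.\<close>

definition IPC_theorems :: "'v fm set" where
  "IPC_theorems = {\<chi>. MP_derivable (ipc_schemes \<inter> Fm_prop) \<chi>}"

definition INT_instances :: "'v fm set" where
  "INT_instances = {subst \<sigma> \<chi> | \<sigma> \<chi>. \<chi> \<in> IPC_theorems}"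

inductive_set IEL_axioms :: "'v fm set" where
  "\<phi> \<in> INT_instances \<Longrightarrow> \<phi> \<in> Fm_e \<Longrightarrow> \<phi> \<in> IEL_axioms"
| "\<phi> \<in> Fm_e \<Longrightarrow> \<psi> \<in> Fm_e \<Longrightarrow> \<^bold>K (\<phi> \<^bold>\<rightarrow> \<psi>) \<^bold>\<rightarrow> (\<^bold>K \<phi> \<^bold>\<rightarrow> \<^bold>K \<psi>) \<in> IEL_axioms"
| "\<phi> \<in> Fm_e \<Longrightarrow> \<phi> \<^bold>\<rightarrow> \<^bold>K \<phi> \<in> IEL_axioms"
| "\<phi> \<in> Fm_e \<Longrightarrow> \<^bold>K \<phi> \<^bold>\<rightarrow> \<^bold>\<not> (\<^bold>\<not> \<phi>) \<in> IEL_axioms"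

definition IEL_derives :: "'v fm set \<Rightarrow> 'v fm \<Rightarrow> bool" (infix "\<turnstile>\<^sub>I\<^sub>E\<^sub>L" 50) where
  "\<Phi> \<turnstile>\<^sub>I\<^sub>E\<^sub>L \<phi> \<longleftrightarrow> MP_derivable (IEL_axioms \<union> \<Phi>) \<phi>"

inductive_set EL5_axioms :: "'v fm set" where
  "\<phi> \<in> INT_instances \<Longrightarrow> \<phi> \<in> EL5_axioms"
| "\<^bold>\<box> (\<phi> \<^bold>\<or> \<psi>) \<^bold>\<rightarrow> (\<^bold>\<box> \<phi> \<^bold>\<or> \<^bold>\<box> \<psi>) \<in> EL5_axioms"
| "\<^bold>\<box> \<phi> \<^bold>\<rightarrow> \<phi> \<in> EL5_axioms"
| "\<^bold>\<box> (\<phi> \<^bold>\<rightarrow> \<psi>) \<^bold>\<rightarrow> \<^bold>\<box> (\<^bold>\<box> \<phi> \<^bold>\<rightarrow> \<^bold>\<box> \<psi>) \<in> EL5_axioms"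
| "\<^bold>\<box> \<phi> \<^bold>\<rightarrow> \<^bold>\<box> (\<^bold>\<box> \<phi>) \<in> EL5_axioms"
| "\<^bold>\<not> (\<^bold>\<box> \<phi>) \<^bold>\<rightarrow> \<^bold>\<box> (\<^bold>\<not> (\<^bold>\<box> \<phi>)) \<in> EL5_axioms"
| "\<phi> \<^bold>\<rightarrow> \<^bold>K \<phi> \<in> EL5_axioms"
| "\<^bold>K \<phi> \<^bold>\<rightarrow> \<^bold>\<not> (\<^bold>\<not> \<phi>) \<in> EL5_axioms"
| "\<^bold>K (\<phi> \<^bold>\<rightarrow> \<psi>) \<^bold>\<rightarrow> (\<^bold>K \<phi> \<^bold>\<rightarrow> \<^bold>K \<psi>) \<in> EL5_axioms"

definition TND :: "'v fm set" where
  "TND = {\<phi> \<^bold>\<or> \<^bold>\<not> \<phi> | \<phi>. True}"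

text \<open>Axiom Necessitation is the set \<open>Box ` EL5_axioms\<close>: it does not apply to \<open>TND\<close>, to premises,
  or to its own results.\<close>

definition EL5_derives :: "'v fm set \<Rightarrow> 'v fm \<Rightarrow> bool" (infix "\<turnstile>\<^sub>E\<^sub>L\<^sub>5" 50) where
  "\<Phi> \<turnstile>\<^sub>E\<^sub>L\<^sub>5 \<phi> \<longleftrightarrow> MP_derivable (EL5_axioms \<union> \<Phi> \<union> TND \<union> Box ` EL5_axioms) \<phi>"

end

theory Submission
  imports Defs
begin

text \<open>From left to right, \<open>\<box>\<close> distributes over implication in \<open>EL5\<^sup>*\<close>, so prefixing every line of an
  \<open>IEL\<close> derivation with \<open>\<box>\<close> gives the skeleton of an \<open>EL5\<^sup>*\<close> derivation.

  From right to left, suppose \<open>\<phi>\<close> is not derivable from \<open>\<Phi>\<close> in \<open>IEL\<close>, and extend \<open>\<Phi>\<close> to a prime \<open>IEL\<close>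
  theory \<open>\<Gamma>\<close> omitting \<open>\<phi>\<close>. Eliminate \<open>\<box>\<close> from the inside out, replacing \<open>\<box> \<psi>\<close> by \<open>\<top>\<close> or \<open>\<bottom>\<close> according
  to whether the translation of \<open>\<psi>\<close> lies in \<open>\<Gamma>\<close>. Translated axioms of \<open>EL5\<^sup>*\<close> lie in \<open>\<Gamma>\<close>; primeness is
  what validates \<open>\<box> (\<phi> \<or> \<psi>) \<rightarrow> \<box> \<phi> \<or> \<box> \<psi>\<close>. Excluded middle need not lie in \<open>\<Gamma>\<close>, but, as in
  Glivenko's theorem, it lies in the theory \<open>{\<chi>. \<not>\<not>\<chi> \<in> \<Gamma>}\<close>, which is still consistent. That theory
  therefore contains the translations of all consequences of \<open>\<box>\<Phi>\<close>, but not that of \<open>\<box> \<phi>\<close>, which is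
  \<open>\<bottom>\<close>.\<close>

section \<open>Modus ponens derivations as an inductive closure\<close>

inductive_set mp_closure :: "'v fm set \<Rightarrow> 'v fm set" for A where
  base: "\<phi> \<in> A \<Longrightarrow> \<phi> \<in> mp_closure A"
| mp: "\<phi> \<^bold>\<rightarrow> \<psi> \<in> mp_closure A \<Longrightarrow> \<phi> \<in> mp_closure A \<Longrightarrow> \<psi> \<in> mp_closure A"

lemma mp_closure_least:
  assumes "\<phi> \<in> mp_closure A" and "A \<subseteq> B"
    and "\<And>\<alpha> \<beta>. \<alpha> \<^bold>\<rightarrow> \<beta> \<in> B \<Longrightarrow> \<alpha> \<in> B \<Longrightarrow> \<beta> \<in> B"
  shows "\<phi> \<in> B"
  using assms(1) by induction (use assms(2,3) in auto)

lemma mp_closure_mono: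
  assumes "A \<subseteq> B"
  shows "mp_closure A \<subseteq> mp_closure B"
proof
  fix \<phi>
  assume "\<phi> \<in> mp_closure A"
  moreover have "A \<subseteq> mp_closure B" using assms by (auto intro: mp_closure.base)
  ultimately show "\<phi> \<in> mp_closure B" by (rule mp_closure_least) (rule mp_closure.mp)
qed

lemma derivation_subset_mp_closure:
  assumes "derivation A ds" and "i < length ds"
  shows "ds ! i \<in> mp_closure A"
  using assms(2)
proof (induction i rule: less_induct)
  case (less i)
  then consider "ds ! i \<in> A" | j k where "j < i" "k < i" "ds ! k = (ds ! j \<^bold>\<rightarrow> ds ! i)"
    using assms(1) unfolding derivation_def by blast
  then show ?case
  proof cases
    case 1
    then show ?thesis by (rule mp_closure.base)
  next
    case 2
    then have "ds ! j \<^bold>\<rightarrow> ds ! i \<in> mp_closure A" and "ds ! j \<in> mp_closure A"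
      using less.IH[of k] less.IH[of j] less.prems by auto
    then show ?thesis by (rule mp_closure.mp)
  qed
qed

lemma derivation_append:
  assumes "derivation A ds" and "derivation A es"
  shows "derivation A (ds @ es)"
  unfolding derivation_def
proof (intro allI impI)
  fix i
  assume i: "i < length (ds @ es)"
  let ?n = "length ds"
  show "(ds @ es) ! i \<in> A \<or> (\<exists>j<i. \<exists>k<i. (ds @ es) ! k = ((ds @ es) ! j \<^bold>\<rightarrow> (ds @ es) ! i))"
  proof (cases "i < ?n")
    case True
    then consider "ds ! i \<in> A" | j k where "j < i" "k < i" "ds ! k = (ds ! j \<^bold>\<rightarrow> ds ! i)"
      using assms(1) unfolding derivation_def by blast
    then show ?thesis
    proof cases
      case 2
      with True have "(ds @ es) ! k = ((ds @ es) ! j \<^bold>\<rightarrow> (ds @ es) ! i)"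
        by (simp add: nth_append)
      with 2 show ?thesis by blast
    qed (use True in \<open>simp add: nth_append\<close>)
  next
    case False
    then obtain i' where i': "i = ?n + i'" "i' < length es"
      using i by (metis add_diff_inverse_nat length_append nat_add_left_cancel_less)
    then consider "es ! i' \<in> A" | j k where "j < i'" "k < i'" "es ! k = (es ! j \<^bold>\<rightarrow> es ! i')"
      using assms(2) unfolding derivation_def by blast
    then show ?thesis
    proof cases
      case 2
      \<comment> \<open>Members of \<open>es\<close> are justified by earlier members of
        \<open>es\<close> only, so shifting both references by \<open>?n\<close> preserves the modus
        ponens step.\<close>
      then have "?n + j < i" "?n + k < i"
        "(ds @ es) ! (?n + k) = ((ds @ es) ! (?n + j) \<^bold>\<rightarrow> (ds @ es) ! i)"
        using i' by simp_all
      then show ?thesis by blast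
    qed (use i' in simp)
  qed
qed

text \<open>Turns every later argument about derivations into a rule induction. For a modus ponens
  step, the two given derivations are concatenated and the conclusion is appended as one further
  line.\<close>

lemma MP_derivable_iff_mp_closure: "MP_derivable A \<phi> \<longleftrightarrow> \<phi> \<in> mp_closure A"
proof
  assume "MP_derivable A \<phi>"
  then obtain ds where "ds \<noteq> []" "derivation A ds" "last ds = \<phi>"
    unfolding MP_derivable_def by blast
  then show "\<phi> \<in> mp_closure A"
    using derivation_subset_mp_closure[of A ds "length ds - 1"] by (simp add: last_conv_nth)
next
  assume "\<phi> \<in> mp_closure A"
  then show "MP_derivable A \<phi>"
  proof induction
    case (base \<phi>)
    then have "derivation A [\<phi>]" by (simp add: derivation_def)
    then show ?case unfolding MP_derivable_def by force
  next
    case (mp \<phi> \<psi>)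
    then obtain ds es where ds: "ds \<noteq> []" "derivation A ds" "last ds = \<phi> \<^bold>\<rightarrow> \<psi>"
      and es: "es \<noteq> []" "derivation A es" "last es = \<phi>"
      unfolding MP_derivable_def by blast
    let ?fs = "ds @ es"
    have fs: "derivation A ?fs" using ds(2) es(2) by (rule derivation_append)
    \<comment> \<open>\<open>k\<close> and \<open>j\<close> point to the final lines of
      \<open>ds\<close> and \<open>es\<close> inside \<open>?fs\<close>, where the implication and
      its antecedent stand.\<close>
    define k where "k = length ds - 1"
    define j where "j = length ds + (length es - 1)"
    have len: "k < length ?fs" "j < length ?fs"
      using ds(1) es(1) by (simp_all add: k_def j_def trans_less_add1)
    have k: "?fs ! k = \<phi> \<^bold>\<rightarrow> \<psi>"
      using ds(1,3) by (simp add: k_def nth_append last_conv_nth)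
    have j: "?fs ! j = \<phi>"
      using es(1,3) by (simp add: j_def nth_append last_conv_nth)
    have "derivation A (?fs @ [\<psi>])"
      unfolding derivation_def
    proof (intro allI impI)
      fix i
      assume "i < length (?fs @ [\<psi>])"
      then consider "i < length ?fs" | "i = length ?fs" by fastforce
      then show "(?fs @ [\<psi>]) ! i \<in> A \<or>
        (\<exists>j<i. \<exists>k<i. (?fs @ [\<psi>]) ! k = ((?fs @ [\<psi>]) ! j \<^bold>\<rightarrow> (?fs @ [\<psi>]) ! i))"
      proof cases
        case 1
        then have "?fs ! i \<in> A \<or> (\<exists>j<i. \<exists>k<i. ?fs ! k = (?fs ! j \<^bold>\<rightarrow> ?fs ! i))"
          using fs unfolding derivation_def by blast
        moreover have nth: "(?fs @ [\<psi>]) ! l = ?fs ! l" if "l \<le> i" for l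
          using 1 that by (subst nth_append) simp
        ultimately show ?thesis using nth by (metis less_imp_le order_refl)
      next
        case 2
        have "(?fs @ [\<psi>]) ! k = ((?fs @ [\<psi>]) ! j \<^bold>\<rightarrow> (?fs @ [\<psi>]) ! i)"
          using len k j 2 by (metis nth_append nth_append_length)
        then show ?thesis using len 2 by blast
      qed
    qed
    then show ?case
      unfolding MP_derivable_def by (metis last_snoc snoc_eq_iff_butlast)
  qed
qed

section \<open>Instances of the intuitionistic schemes\<close>

lemma subst_mem_INT_instances:
  "\<chi> \<in> ipc_schemes \<Longrightarrow> \<chi> \<in> Fm_prop \<Longrightarrow> subst \<sigma> \<chi> \<in> INT_instances"
  unfolding INT_instances_def IPC_theorems_def MP_derivable_iff_mp_closure
  by (blast intro: mp_closure.base)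

text \<open>\<open>INT_instances\<close> only substitutes into theorems free of box and
  \<open>K\<close>, whereas \<open>ipc_schemes\<close> ranges over all formulas. Each scheme is
  therefore taken at distinct variables, at most three, and the actual formulas are substituted for
  them.\<close>

lemma ipc_schemes_subset_INT_instances:
  assumes "infinite (UNIV :: 'v set)"
  shows "(ipc_schemes :: 'v fm set) \<subseteq> INT_instances"
proof
  \<comment> \<open>\<open>x\<close> is arbitrary. Choosing \<open>y\<close> and \<open>z\<close>
    distinct from it and from each other keeps the updates of \<open>Var\<close> below from
    overwriting one another.\<close>
  obtain x :: 'v where True by blast
  obtain y where y: "y \<noteq> x" using ex_new_if_finite[OF assms, of "{x}"] by auto
  obtain z where z: "z \<noteq> x" "z \<noteq> y" using ex_new_if_finite[OF assms, of "{x, y}"] by auto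
  fix \<chi> :: "'v fm"
  assume "\<chi> \<in> ipc_schemes"
  then show "\<chi> \<in> INT_instances"
  proof cases
    case (1 \<alpha> \<beta>)
    then show ?thesis
      using subst_mem_INT_instances[OF ipc_schemes.intros(1)[of "Var x" "Var y"],
        of "Var(x := \<alpha>, y := \<beta>)"] y by (simp add: Fm_prop_def)
  next
    case (2 \<alpha> \<beta> \<gamma>)
    then show ?thesis
      using subst_mem_INT_instances[OF ipc_schemes.intros(2)[of "Var x" "Var y" "Var z"],
        of "Var(x := \<alpha>, y := \<beta>, z := \<gamma>)"] y z by (simp add: Fm_prop_def)
  next
    case (3 \<alpha> \<beta>)
    then show ?thesis
      using subst_mem_INT_instances[OF ipc_schemes.intros(3)[of "Var x" "Var y"],
        of "Var(x := \<alpha>, y := \<beta>)"] y by (simp add: Fm_prop_def)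
  next
    case (4 \<alpha> \<beta>)
    then show ?thesis
      using subst_mem_INT_instances[OF ipc_schemes.intros(4)[of "Var x" "Var y"],
        of "Var(x := \<alpha>, y := \<beta>)"] y by (simp add: Fm_prop_def)
  next
    case (5 \<alpha> \<beta>)
    then show ?thesis
      using subst_mem_INT_instances[OF ipc_schemes.intros(5)[of "Var x" "Var y"],
        of "Var(x := \<alpha>, y := \<beta>)"] y by (simp add: Fm_prop_def)
  next
    case (6 \<alpha> \<beta>)
    then show ?thesis
      using subst_mem_INT_instances[OF ipc_schemes.intros(6)[of "Var x" "Var y"],
        of "Var(x := \<alpha>, y := \<beta>)"] y by (simp add: Fm_prop_def)
  next
    case (7 \<beta> \<alpha>)
    then show ?thesis
      using subst_mem_INT_instances[OF ipc_schemes.intros(7)[of "Var y" "Var x"],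
        of "Var(x := \<alpha>, y := \<beta>)"] y by (simp add: Fm_prop_def)
  next
    case (8 \<alpha> \<gamma> \<beta>)
    then show ?thesis
      using subst_mem_INT_instances[OF ipc_schemes.intros(8)[of "Var x" "Var z" "Var y"],
        of "Var(x := \<alpha>, y := \<beta>, z := \<gamma>)"] y z by (simp add: Fm_prop_def)
  next
    case (9 \<alpha>)
    then show ?thesis
      using subst_mem_INT_instances[OF ipc_schemes.intros(9)[of "Var x"],
        of "Var(x := \<alpha>)"] by (simp add: Fm_prop_def)
  qed
qed

lemma IPC_theorems_subset_Fm_prop: "(IPC_theorems :: 'v fm set) \<subseteq> Fm_prop"
proof
  fix \<phi> :: "'v fm"
  assume "\<phi> \<in> IPC_theorems"
  then have "\<phi> \<in> mp_closure (ipc_schemes \<inter> Fm_prop)"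
    by (simp add: IPC_theorems_def MP_derivable_iff_mp_closure)
  then show "\<phi> \<in> Fm_prop" by (rule mp_closure_least) (auto simp: Fm_prop_def)
qed

lemma IEL_axioms_subset_Fm_e: "IEL_axioms \<subseteq> Fm_e"
  by (auto elim!: IEL_axioms.cases simp: Fm_e_def)

lemma IEL_axioms_subset_EL5_axioms: "IEL_axioms \<subseteq> EL5_axioms"
  by (auto elim!: IEL_axioms.cases intro: EL5_axioms.intros)

lemma mp_closure_subset_Fm_e:
  assumes "A \<subseteq> Fm_e"
  shows "mp_closure A \<subseteq> Fm_e"
proof
  fix \<phi>
  assume "\<phi> \<in> mp_closure A"
  then show "\<phi> \<in> Fm_e" using assms by (rule mp_closure_least) (auto simp: Fm_e_def)
qed

section \<open>Theories closed under intuitionistic consequence\<close>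

locale int_theory =
  fixes \<Gamma> :: "'v fm set"
  assumes sub_Fm_e: "\<Gamma> \<subseteq> Fm_e"
    and ipc: "ipc_schemes \<inter> Fm_e \<subseteq> \<Gamma>"
    and mp: "\<alpha> \<^bold>\<rightarrow> \<beta> \<in> \<Gamma> \<Longrightarrow> \<alpha> \<in> \<Gamma> \<Longrightarrow> \<beta> \<in> \<Gamma>"
begin

lemma mem_Fm_e: "\<alpha> \<in> \<Gamma> \<Longrightarrow> \<alpha> \<in> Fm_e"
  using sub_Fm_e by blast

lemma ex_falso: "\<alpha> \<in> Fm_e \<Longrightarrow> \<^bold>\<bottom> \<^bold>\<rightarrow> \<alpha> \<in> \<Gamma>"
  using ipc ipc_schemes.intros(9)[of \<alpha>] by (auto simp: Fm_e_def)

lemma weaken: "\<alpha> \<in> \<Gamma> \<Longrightarrow> \<beta> \<in> Fm_e \<Longrightarrow> \<beta> \<^bold>\<rightarrow> \<alpha> \<in> \<Gamma>"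
  using ipc ipc_schemes.intros(1)[of \<alpha> \<beta>] mem_Fm_e[of \<alpha>] by (auto simp: Fm_e_def intro: mp)

lemma or_introL: "\<alpha> \<in> \<Gamma> \<Longrightarrow> \<beta> \<in> Fm_e \<Longrightarrow> \<alpha> \<^bold>\<or> \<beta> \<in> \<Gamma>"
  using ipc ipc_schemes.intros(6)[of \<alpha> \<beta>] mem_Fm_e[of \<alpha>] by (auto simp: Fm_e_def intro: mp)

lemma or_introR: "\<beta> \<in> \<Gamma> \<Longrightarrow> \<alpha> \<in> Fm_e \<Longrightarrow> \<alpha> \<^bold>\<or> \<beta> \<in> \<Gamma>"
  using ipc ipc_schemes.intros(7)[of \<beta> \<alpha>] mem_Fm_e[of \<beta>] by (auto simp: Fm_e_def intro: mp)

lemma or_elim: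
  assumes "\<alpha> \<^bold>\<or> \<beta> \<in> \<Gamma>" "\<alpha> \<^bold>\<rightarrow> \<gamma> \<in> \<Gamma>" "\<beta> \<^bold>\<rightarrow> \<gamma> \<in> \<Gamma>"
  shows "\<gamma> \<in> \<Gamma>"
proof -
  have "(\<alpha> \<^bold>\<rightarrow> \<gamma>) \<^bold>\<rightarrow> ((\<beta> \<^bold>\<rightarrow> \<gamma>) \<^bold>\<rightarrow> ((\<alpha> \<^bold>\<or> \<beta>) \<^bold>\<rightarrow> \<gamma>)) \<in> \<Gamma>"
    using ipc ipc_schemes.intros(8)[of \<alpha> \<gamma> \<beta>] assms[THEN mem_Fm_e] by (auto simp: Fm_e_def)
  then show ?thesis using assms by (blast intro: mp)
qed

lemma imp_distrib:
  assumes "\<alpha> \<^bold>\<rightarrow> (\<beta> \<^bold>\<rightarrow> \<gamma>) \<in> \<Gamma>" "\<alpha> \<^bold>\<rightarrow> \<beta> \<in> \<Gamma>"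
  shows "\<alpha> \<^bold>\<rightarrow> \<gamma> \<in> \<Gamma>"
proof -
  have "(\<alpha> \<^bold>\<rightarrow> (\<beta> \<^bold>\<rightarrow> \<gamma>)) \<^bold>\<rightarrow> ((\<alpha> \<^bold>\<rightarrow> \<beta>) \<^bold>\<rightarrow> (\<alpha> \<^bold>\<rightarrow> \<gamma>)) \<in> \<Gamma>"
    using ipc ipc_schemes.intros(2)[of \<alpha> \<beta> \<gamma>] assms[THEN mem_Fm_e] by (auto simp: Fm_e_def)
  then show ?thesis using assms by (blast intro: mp)
qed

lemma imp_refl:
  assumes "\<alpha> \<in> Fm_e"
  shows "\<alpha> \<^bold>\<rightarrow> \<alpha> \<in> \<Gamma>"
proof (rule imp_distrib)
  show "\<alpha> \<^bold>\<rightarrow> ((\<alpha> \<^bold>\<rightarrow> \<alpha>) \<^bold>\<rightarrow> \<alpha>) \<in> \<Gamma>" and "\<alpha> \<^bold>\<rightarrow> (\<alpha> \<^bold>\<rightarrow> \<alpha>) \<in> \<Gamma>"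
    using ipc ipc_schemes.intros(1)[of \<alpha> \<alpha>] ipc_schemes.intros(1)[of \<alpha> "\<alpha> \<^bold>\<rightarrow> \<alpha>"] assms
    by (auto simp: Fm_e_def)
qed

text \<open>The usual induction works because modus ponens is the only closure rule: members of
  \<Gamma> are weakened, \<alpha> itself uses \<open>imp_refl\<close>, and modus ponens becomes
  \<open>imp_distrib\<close>.\<close>

lemma deduction:
  assumes "\<beta> \<in> mp_closure (insert \<alpha> \<Gamma>)" and "\<alpha> \<in> Fm_e"
  shows "\<alpha> \<^bold>\<rightarrow> \<beta> \<in> \<Gamma>"
  using assms(1)
proof induction
  case (base \<beta>)
  then show ?case using assms(2) by (auto intro: imp_refl weaken)
qed (rule imp_distrib)

text \<open>Supports natural-deduction style reasoning: the locale is interpreted anew under a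
  temporary hypothesis, which \<open>deduction\<close> later discharges.\<close>

lemma int_theory_insert:
  assumes "\<alpha> \<in> Fm_e"
  shows "int_theory (mp_closure (insert \<alpha> \<Gamma>))"
proof
  show "mp_closure (insert \<alpha> \<Gamma>) \<subseteq> Fm_e"
    using assms sub_Fm_e by (intro mp_closure_subset_Fm_e) auto
  show "ipc_schemes \<inter> Fm_e \<subseteq> mp_closure (insert \<alpha> \<Gamma>)"
    using ipc by (auto intro: mp_closure.base)
qed (rule mp_closure.mp)

lemma not_not_intro:
  assumes "\<alpha> \<in> \<Gamma>"
  shows "\<^bold>\<not> (\<^bold>\<not> \<alpha>) \<in> \<Gamma>"
proof (rule deduction)
  show "\<^bold>\<bottom> \<in> mp_closure (insert (\<^bold>\<not> \<alpha>) \<Gamma>)"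
    using assms by (auto intro: mp_closure.intros)
  show "\<^bold>\<not> \<alpha> \<in> Fm_e" using mem_Fm_e[OF assms] by (simp add: Fm_e_def)
qed

text \<open>Assume in turn \<not>\<beta>, \<alpha> \<rightarrow> \<beta> and \<alpha>, which is
  absurd. Discharging \<alpha> contradicts \<not>\<not>\<alpha>; discharging \<alpha> \<rightarrow>
  \<beta> then contradicts its double negation, and discharging \<not>\<beta> gives the
  claim.\<close>

lemma not_not_mp:
  assumes "\<^bold>\<not> (\<^bold>\<not> (\<alpha> \<^bold>\<rightarrow> \<beta>)) \<in> \<Gamma>" and "\<^bold>\<not> (\<^bold>\<not> \<alpha>) \<in> \<Gamma>"
  shows "\<^bold>\<not> (\<^bold>\<not> \<beta>) \<in> \<Gamma>"
proof (rule deduction)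
  let ?\<Gamma>1 = "mp_closure (insert (\<^bold>\<not> \<beta>) \<Gamma>)"
  let ?\<Gamma>2 = "mp_closure (insert (\<alpha> \<^bold>\<rightarrow> \<beta>) ?\<Gamma>1)"
  have Fm: "\<alpha> \<in> Fm_e" "\<alpha> \<^bold>\<rightarrow> \<beta> \<in> Fm_e" "\<^bold>\<not> \<beta> \<in> Fm_e"
    using assms[THEN mem_Fm_e] by (auto simp: Fm_e_def)
  show "\<^bold>\<not> \<beta> \<in> Fm_e" by fact
  interpret g1: int_theory ?\<Gamma>1 by (rule int_theory_insert) fact
  interpret g2: int_theory ?\<Gamma>2 by (rule g1.int_theory_insert) fact
  have "\<^bold>\<not> \<beta> \<in> ?\<Gamma>1" by (auto intro: mp_closure.base)
  then have "\<^bold>\<bottom> \<in> mp_closure (insert \<alpha> ?\<Gamma>2)"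
    by (meson insertI1 insertI2 mp_closure.intros)
  then have "\<^bold>\<not> \<alpha> \<in> ?\<Gamma>2" using Fm(1) by (rule g2.deduction)
  moreover have "\<^bold>\<not> (\<^bold>\<not> \<alpha>) \<in> ?\<Gamma>2"
    using assms(2) by (auto intro: mp_closure.base)
  ultimately have "\<^bold>\<bottom> \<in> ?\<Gamma>2" by (blast intro: g2.mp)
  then have "\<^bold>\<not> (\<alpha> \<^bold>\<rightarrow> \<beta>) \<in> ?\<Gamma>1" using Fm(2) by (rule g1.deduction)
  moreover have "\<^bold>\<not> (\<^bold>\<not> (\<alpha> \<^bold>\<rightarrow> \<beta>)) \<in> ?\<Gamma>1"
    using assms(1) by (auto intro: mp_closure.base)
  ultimately show "\<^bold>\<bottom> \<in> ?\<Gamma>1" by (blast intro: g1.mp)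
qed

text \<open>Suppose excluded middle for \<alpha> is refuted. Then \<alpha> is absurd, since it
  yields the left disjunct; so \<not>\<alpha> holds, which yields the right one.\<close>

lemma not_not_tnd:
  assumes "\<alpha> \<in> Fm_e"
  shows "\<^bold>\<not> (\<^bold>\<not> (\<alpha> \<^bold>\<or> \<^bold>\<not> \<alpha>)) \<in> \<Gamma>"
proof (rule deduction)
  let ?\<tau> = "\<alpha> \<^bold>\<or> \<^bold>\<not> \<alpha>"
  let ?\<Gamma>1 = "mp_closure (insert (\<^bold>\<not> ?\<tau>) \<Gamma>)"
  let ?\<Gamma>2 = "mp_closure (insert \<alpha> ?\<Gamma>1)"
  have Fm: "\<^bold>\<not> \<alpha> \<in> Fm_e" "\<^bold>\<not> ?\<tau> \<in> Fm_e"
    using assms by (auto simp: Fm_e_def)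
  show "\<^bold>\<not> ?\<tau> \<in> Fm_e" by fact
  interpret g1: int_theory ?\<Gamma>1 by (rule int_theory_insert) fact
  interpret g2: int_theory ?\<Gamma>2 by (rule g1.int_theory_insert) fact
  have neg: "\<^bold>\<not> ?\<tau> \<in> ?\<Gamma>1" by (auto intro: mp_closure.base)
  have "?\<tau> \<in> ?\<Gamma>2" using Fm(1) by (auto intro: g2.or_introL mp_closure.base)
  moreover have "\<^bold>\<not> ?\<tau> \<in> ?\<Gamma>2" using neg by (auto intro: mp_closure.base)
  ultimately have "\<^bold>\<bottom> \<in> ?\<Gamma>2" by (blast intro: g2.mp)
  then have "\<^bold>\<not> \<alpha> \<in> ?\<Gamma>1" using assms by (rule g1.deduction)
  then have "?\<tau> \<in> ?\<Gamma>1" using assms by (rule g1.or_introR)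
  with neg show "\<^bold>\<bottom> \<in> ?\<Gamma>1" by (blast intro: g1.mp)
qed

end

section \<open>Eliminating box relative to a theory\<close>

primrec box_eval :: "'v fm set \<Rightarrow> 'v fm \<Rightarrow> 'v fm" where
  "box_eval \<Gamma> (Var x) = Var x"
| "box_eval \<Gamma> \<^bold>\<bottom> = \<^bold>\<bottom>"
| "box_eval \<Gamma> (\<phi> \<^bold>\<and> \<psi>) = box_eval \<Gamma> \<phi> \<^bold>\<and> box_eval \<Gamma> \<psi>"
| "box_eval \<Gamma> (\<phi> \<^bold>\<or> \<psi>) = box_eval \<Gamma> \<phi> \<^bold>\<or> box_eval \<Gamma> \<psi>"
| "box_eval \<Gamma> (\<phi> \<^bold>\<rightarrow> \<psi>) = box_eval \<Gamma> \<phi> \<^bold>\<rightarrow> box_eval \<Gamma> \<psi>"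
| "box_eval \<Gamma> (\<^bold>\<box> \<phi>) = (if box_eval \<Gamma> \<phi> \<in> \<Gamma> then \<^bold>\<not> \<^bold>\<bottom> else \<^bold>\<bottom>)"
| "box_eval \<Gamma> (\<^bold>K \<phi>) = \<^bold>K (box_eval \<Gamma> \<phi>)"

lemma box_eval_mem_Fm_e [simp]: "box_eval \<Gamma> \<phi> \<in> Fm_e"
  by (induction \<phi>) (auto simp: Fm_e_def)

lemma box_eval_box_free: "\<phi> \<in> Fm_e \<Longrightarrow> box_eval \<Gamma> \<phi> = \<phi>"
  by (induction \<phi>) (auto simp: Fm_e_def)

text \<open>In an instance of a box-free pattern, boxes occur only inside the substituted formulas,
  so evaluation can be moved into the substitution. Thus an instance of an intuitionistic theorem is
  sent to another instance of the same theorem.\<close>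

lemma box_eval_subst:
  "box_free \<chi> \<Longrightarrow> box_eval \<Gamma> (subst \<sigma> \<chi>) = subst (\<lambda>x. box_eval \<Gamma> (\<sigma> x)) \<chi>"
  by (induction \<chi>) auto

lemma box_eval_INT_instances:
  assumes "\<phi> \<in> INT_instances"
  shows "box_eval \<Gamma> \<phi> \<in> INT_instances"
proof -
  obtain \<sigma> \<chi> where "\<phi> = subst \<sigma> \<chi>" and \<chi>: "\<chi> \<in> IPC_theorems"
    using assms unfolding INT_instances_def by blast
  moreover have "box_free \<chi>" using \<chi> IPC_theorems_subset_Fm_prop by (auto simp: Fm_prop_def)
  ultimately show ?thesis unfolding INT_instances_def by (auto simp: box_eval_subst)
qed

locale prime_IEL_theory = int_theory +
  assumes IEL: "IEL_axioms \<subseteq> \<Gamma>"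
    and prime: "\<alpha> \<^bold>\<or> \<beta> \<in> \<Gamma> \<Longrightarrow> \<alpha> \<in> \<Gamma> \<or> \<beta> \<in> \<Gamma>"
    and consistent: "\<^bold>\<bottom> \<notin> \<Gamma>"
begin

lemma top: "\<^bold>\<not> \<^bold>\<bottom> \<in> \<Gamma>"
  by (rule ex_falso) (simp add: Fm_e_def)

text \<open>A box evaluates to verum, which is in \<Gamma>, or to \<bottom>, which consistency keeps
  out. An outermost box can therefore be dropped whenever only membership in \<Gamma>
  matters.\<close>

lemma box_eval_Box_mem_iff: "box_eval \<Gamma> (\<^bold>\<box> \<phi>) \<in> \<Gamma> \<longleftrightarrow> box_eval \<Gamma> \<phi> \<in> \<Gamma>"
  using top consistent by simp

text \<open>If the antecedent evaluates to \<bottom>, ex falso applies; otherwise the consequent is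
  in \<Gamma> by assumption and is weakened. This settles the axioms whose antecedent is a
  box.\<close>

lemma box_eval_Box_imp_mem:
  assumes "box_eval \<Gamma> \<phi> \<in> \<Gamma> \<Longrightarrow> box_eval \<Gamma> \<chi> \<in> \<Gamma>"
  shows "box_eval \<Gamma> (\<^bold>\<box> \<phi> \<^bold>\<rightarrow> \<chi>) \<in> \<Gamma>"
  using assms by (auto intro: weaken ex_falso mem_Fm_e[OF top])

lemma box_eval_EL5_axioms_mem:
  assumes "\<phi> \<in> EL5_axioms"
  shows "box_eval \<Gamma> \<phi> \<in> \<Gamma>"
  using assms
proof cases
  case 1
  then show ?thesis using IEL by (blast intro: IEL_axioms.intros box_eval_INT_instances box_eval_mem_Fm_e)
next
  case (2 \<alpha> \<beta>)
  have "box_eval \<Gamma> (\<^bold>\<box> \<alpha> \<^bold>\<or> \<^bold>\<box> \<beta>) \<in> \<Gamma>" if "box_eval \<Gamma> (\<alpha> \<^bold>\<or> \<beta>) \<in> \<Gamma>"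
  proof -
    have "box_eval \<Gamma> (\<^bold>\<box> \<alpha>) \<in> \<Gamma> \<or> box_eval \<Gamma> (\<^bold>\<box> \<beta>) \<in> \<Gamma>"
      using that prime unfolding box_eval_Box_mem_iff by simp
    then show ?thesis
      unfolding box_eval.simps(4) by (metis or_introL or_introR box_eval_mem_Fm_e)
  qed
  then show ?thesis unfolding 2 by (rule box_eval_Box_imp_mem)
next
  case (3 \<alpha>)
  then show ?thesis using box_eval_Box_imp_mem by blast
next
  case (4 \<alpha> \<beta>)
  have "box_eval \<Gamma> (\<^bold>\<box> (\<^bold>\<box> \<alpha> \<^bold>\<rightarrow> \<^bold>\<box> \<beta>)) \<in> \<Gamma>" if "box_eval \<Gamma> (\<alpha> \<^bold>\<rightarrow> \<beta>) \<in> \<Gamma>"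
    \<comment> \<open>With the outer box dropped, what remains is an implication between boxes, and
      it reduces to closure of \<Gamma> under modus ponens.\<close>
    unfolding box_eval_Box_mem_iff
  proof (rule box_eval_Box_imp_mem)
    assume "box_eval \<Gamma> \<alpha> \<in> \<Gamma>"
    then have "box_eval \<Gamma> \<beta> \<in> \<Gamma>" using that mp by simp
    then show "box_eval \<Gamma> (\<^bold>\<box> \<beta>) \<in> \<Gamma>" unfolding box_eval_Box_mem_iff .
  qed
  then show ?thesis unfolding 4 by (rule box_eval_Box_imp_mem)
next
  case (5 \<alpha>)
  show ?thesis unfolding 5 by (rule box_eval_Box_imp_mem) (unfold box_eval_Box_mem_iff)
next
  case (6 \<alpha>)
  let ?b = "box_eval \<Gamma> (\<^bold>\<box> \<alpha>)"
  show ?thesis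
  proof (cases "box_eval \<Gamma> \<alpha> \<in> \<Gamma>")
    case True
    \<comment> \<open>Here the consequent of the axiom evaluates to \<bottom>, so the whole axiom
      evaluates to the double negation of \<open>?b\<close>.\<close>
    then have "\<^bold>\<not> (\<^bold>\<not> ?b) \<in> \<Gamma>" by (intro not_not_intro) (unfold box_eval_Box_mem_iff)
    moreover from this have "\<^bold>\<not> ?b \<notin> \<Gamma>" using consistent mp by blast
    then have "box_eval \<Gamma> (\<^bold>\<box> (\<^bold>\<not> (\<^bold>\<box> \<alpha>))) = \<^bold>\<bottom>" by simp
    ultimately show ?thesis unfolding 6 by (simp only: box_eval.simps(2,5))
  next
    case False
    \<comment> \<open>Now the box evaluates to \<bottom> and its negation to verum, so the
      consequent is already in \<Gamma>.\<close>
    then have "box_eval \<Gamma> (\<^bold>\<not> (\<^bold>\<box> \<alpha>)) \<in> \<Gamma>" using top by simp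
    then have "box_eval \<Gamma> (\<^bold>\<box> (\<^bold>\<not> (\<^bold>\<box> \<alpha>))) \<in> \<Gamma>" unfolding box_eval_Box_mem_iff .
    then show ?thesis
      unfolding 6 box_eval.simps(5)[of _ "\<^bold>\<not> (\<^bold>\<box> \<alpha>)"] by (rule weaken) (rule box_eval_mem_Fm_e)
  qed
next
  case (7 \<alpha>)
  then show ?thesis using IEL IEL_axioms.intros(3)[of "box_eval \<Gamma> \<alpha>"] by auto
next
  case (8 \<alpha>)
  then show ?thesis using IEL IEL_axioms.intros(4)[of "box_eval \<Gamma> \<alpha>"] by auto
next
  case (9 \<alpha> \<beta>)
  then show ?thesis
    using IEL IEL_axioms.intros(2)[of "box_eval \<Gamma> \<alpha>" "box_eval \<Gamma> \<beta>"] by auto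
qed

text \<open>Evaluated axioms lie in \<Gamma> itself, not merely up to double negation. Hence their
  boxes evaluate to verum, which makes Axiom Necessitation sound; an instance of \<open>TND\<close>
  offers only its double negation.\<close>

lemma EL5_derives_not_not_mem:
  assumes "\<Psi> \<turnstile>\<^sub>E\<^sub>L\<^sub>5 \<chi>" and "\<And>\<psi>. \<psi> \<in> \<Psi> \<Longrightarrow> box_eval \<Gamma> \<psi> \<in> \<Gamma>"
  shows "\<^bold>\<not> (\<^bold>\<not> (box_eval \<Gamma> \<chi>)) \<in> \<Gamma>"
  using assms(1) unfolding EL5_derives_def MP_derivable_iff_mp_closure
proof induction
  case (base \<chi>)
  then consider "\<chi> \<in> EL5_axioms \<or> \<chi> \<in> \<Psi>" | \<alpha> where "\<chi> = \<alpha> \<^bold>\<or> \<^bold>\<not> \<alpha>"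
    | \<alpha> where "\<alpha> \<in> EL5_axioms" "\<chi> = \<^bold>\<box> \<alpha>"
    unfolding TND_def by blast
  then show ?case
  proof cases
    case 1
    then show ?thesis using assms(2) box_eval_EL5_axioms_mem not_not_intro by blast
  next
    case 2
    then show ?thesis using not_not_tnd[of "box_eval \<Gamma> \<alpha>"] by simp
  next
    case 3
    then show ?thesis
      using box_eval_EL5_axioms_mem not_not_intro box_eval_Box_mem_iff by blast
  qed
next
  case (mp \<alpha> \<beta>)
  then show ?case by (simp add: not_not_mp)
qed

text \<open>On boxed formulas the double negation can be removed: the only alternative to verum is
  \<bottom>, whose double negation is inconsistent.\<close>

lemma EL5_derives_Box_mem:
  assumes "\<Psi> \<turnstile>\<^sub>E\<^sub>L\<^sub>5 \<^bold>\<box> \<chi>" and "\<And>\<psi>. \<psi> \<in> \<Psi> \<Longrightarrow> box_eval \<Gamma> \<psi> \<in> \<Gamma>"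
  shows "box_eval \<Gamma> \<chi> \<in> \<Gamma>"
proof (rule ccontr)
  assume "box_eval \<Gamma> \<chi> \<notin> \<Gamma>"
  then have "\<^bold>\<not> (\<^bold>\<not> \<^bold>\<bottom>) \<in> \<Gamma>" using EL5_derives_not_not_mem[OF assms] by simp
  then show False using top mp consistent by blast
qed

end

section \<open>Extension to a prime theory by Zorn's lemma\<close>

lemma mp_closure_Union_chain:
  assumes "\<phi> \<in> mp_closure (\<Union>C)" and "subset.chain \<A> C" and "C \<noteq> {}"
  shows "\<exists>S\<in>C. \<phi> \<in> mp_closure S"
  using assms(1)
proof induction
  case (base \<phi>)
  then show ?case by (auto intro: mp_closure.base)
next
  case (mp \<alpha> \<beta>)
  then obtain S T where S: "S \<in> C" "\<alpha> \<^bold>\<rightarrow> \<beta> \<in> mp_closure S" and T: "T \<in> C" "\<alpha> \<in> mp_closure T"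
    by blast
  \<comment> \<open>The two premises may come from different members of the chain; the larger member
    derives both.\<close>
  have "S \<subseteq> T \<or> T \<subseteq> S" using assms(2) S(1) T(1) by (auto simp: subset.chain_def)
  then have "S \<union> T \<in> C" using S(1) T(1) by (metis sup.absorb1 sup.absorb2)
  moreover have "\<beta> \<in> mp_closure (S \<union> T)"
    using S(2) T(2) mp_closure_mono[of S "S \<union> T"] mp_closure_mono[of T "S \<union> T"]
    by (blast intro: mp_closure.mp)
  ultimately show ?case by blast
qed

text \<open>Lindenbaum's construction. Zorn's lemma replaces an enumeration of formulas, since the
  type of variables may be uncountable.\<close>

lemma prime_extension:
  assumes "infinite (UNIV :: 'v set)" and "\<Phi> \<subseteq> Fm_e" and "\<phi> \<in> Fm_e"
    and "\<not> \<Phi> \<turnstile>\<^sub>I\<^sub>E\<^sub>L (\<phi> :: 'v fm)"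
  obtains \<Gamma> where "prime_IEL_theory \<Gamma>" "\<Phi> \<subseteq> \<Gamma>" "\<phi> \<notin> \<Gamma>"
proof -
  let ?A = "IEL_axioms \<union> \<Phi>"
  \<comment> \<open>Candidates need not be closed under modus ponens; it is their closure that must
    omit \<phi>. Closedness of \<Gamma> itself is then a consequence of maximality.\<close>
  let ?\<A> = "{S. ?A \<subseteq> S \<and> S \<subseteq> Fm_e \<and> \<phi> \<notin> mp_closure S}"
  have "?A \<in> ?\<A>"
    using assms(2,4) IEL_axioms_subset_Fm_e
    by (auto simp: IEL_derives_def MP_derivable_iff_mp_closure)
  then have "?\<A> \<noteq> {}" by blast
  moreover have "\<Union>C \<in> ?\<A>" if C: "C \<noteq> {}" "subset.chain ?\<A> C" for C
  proof -
    have sub: "C \<subseteq> ?\<A>" using C(2) by (simp add: subset.chain_def)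
    have "\<phi> \<notin> mp_closure (\<Union>C)"
      using mp_closure_Union_chain[OF _ C(2) C(1)] sub by blast
    moreover have "?A \<subseteq> \<Union>C" using C(1) sub by blast
    moreover have "\<Union>C \<subseteq> Fm_e" using sub by blast
    ultimately show ?thesis by blast
  qed
  ultimately have "\<exists>\<Gamma>\<in>?\<A>. \<forall>S\<in>?\<A>. \<Gamma> \<subseteq> S \<longrightarrow> S = \<Gamma>" by (rule subset_Zorn_nonempty)
  then obtain \<Gamma> where \<Gamma>: "\<Gamma> \<in> ?\<A>" and max: "\<forall>S\<in>?\<A>. \<Gamma> \<subseteq> S \<longrightarrow> S = \<Gamma>" ..
  have mem: "\<alpha> \<in> \<Gamma>" if "\<phi> \<notin> mp_closure (insert \<alpha> \<Gamma>)" "\<alpha> \<in> Fm_e" for \<alpha>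
  proof -
    have "insert \<alpha> \<Gamma> \<in> ?\<A>" using \<Gamma> that by auto
    with max have "insert \<alpha> \<Gamma> = \<Gamma>" by auto
    then show ?thesis by blast
  qed
  have closed: "\<alpha> \<in> \<Gamma>" if "\<alpha> \<in> mp_closure \<Gamma>" for \<alpha>
  proof (rule mem)
    show "\<alpha> \<in> Fm_e" using that \<Gamma> mp_closure_subset_Fm_e[of \<Gamma>] by blast
    have "\<chi> \<in> mp_closure \<Gamma>" if "\<chi> \<in> mp_closure (insert \<alpha> \<Gamma>)" for \<chi>
      using that
    proof (rule mp_closure_least)
      show "insert \<alpha> \<Gamma> \<subseteq> mp_closure \<Gamma>"
        using \<open>\<alpha> \<in> mp_closure \<Gamma>\<close> by (auto intro: mp_closure.base)
    qed (rule mp_closure.mp)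
    then show "\<phi> \<notin> mp_closure (insert \<alpha> \<Gamma>)" using \<Gamma> by blast
  qed
  interpret int_theory \<Gamma>
  proof
    show "\<Gamma> \<subseteq> Fm_e" using \<Gamma> by blast
    \<comment> \<open>The infinite supply of variables enters here, through the representation of
      schemes as substitution instances.\<close>
    show "ipc_schemes \<inter> Fm_e \<subseteq> \<Gamma>"
      using ipc_schemes_subset_INT_instances[OF assms(1)] \<Gamma> by (auto intro: IEL_axioms.intros(1))
    show "\<beta> \<in> \<Gamma>" if "\<alpha> \<^bold>\<rightarrow> \<beta> \<in> \<Gamma>" "\<alpha> \<in> \<Gamma>" for \<alpha> \<beta>
      using that by (intro closed) (blast intro: mp_closure.intros)
  qed
  have \<phi>: "\<phi> \<notin> \<Gamma>" using \<Gamma> by (blast intro: mp_closure.base)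
  \<comment> \<open>By maximality, adding any box-free formula outside \<Gamma> makes \<phi>
    derivable. If both disjuncts of a member were outside, each would imply \<phi>, and case
    distinction would put \<phi> into \<Gamma>; this gives primeness below.\<close>
  have imp: "\<alpha> \<^bold>\<rightarrow> \<phi> \<in> \<Gamma>" if "\<alpha> \<notin> \<Gamma>" "\<alpha> \<in> Fm_e" for \<alpha>
    using that mem deduction by blast
  have "prime_IEL_theory \<Gamma>"
  proof
    show "IEL_axioms \<subseteq> \<Gamma>" using \<Gamma> by blast
    show "\<^bold>\<bottom> \<notin> \<Gamma>" using \<phi> ex_falso[OF assms(3)] mp by blast
    show "\<alpha> \<in> \<Gamma> \<or> \<beta> \<in> \<Gamma>" if "\<alpha> \<^bold>\<or> \<beta> \<in> \<Gamma>" for \<alpha> \<beta>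
    proof (rule ccontr)
      assume "\<not> (\<alpha> \<in> \<Gamma> \<or> \<beta> \<in> \<Gamma>)"
      moreover have "\<alpha> \<in> Fm_e" "\<beta> \<in> Fm_e" using mem_Fm_e[OF that] by (auto simp: Fm_e_def)
      ultimately have "\<phi> \<in> \<Gamma>" using or_elim[OF that] imp by blast
      then show False using \<phi> by contradiction
    qed
  qed
  moreover have "\<Phi> \<subseteq> \<Gamma>" using \<Gamma> by blast
  ultimately show thesis using \<phi> by (intro that)
qed

section \<open>The two directions of the equivalence\<close>

lemma IEL_derives_imp_EL5_derives_Box:
  assumes "\<Phi> \<turnstile>\<^sub>I\<^sub>E\<^sub>L \<phi>"
  shows "Box ` \<Phi> \<turnstile>\<^sub>E\<^sub>L\<^sub>5 \<^bold>\<box> \<phi>"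
  using assms
  unfolding IEL_derives_def EL5_derives_def MP_derivable_iff_mp_closure
proof induction
  case (base \<phi>)
  then show ?case using IEL_axioms_subset_EL5_axioms by (auto intro: mp_closure.base)
next
  case (mp \<alpha> \<beta>)
  let ?C = "mp_closure (EL5_axioms \<union> Box ` \<Phi> \<union> TND \<union> Box ` EL5_axioms)"
  have ax: "\<chi> \<in> ?C" if "\<chi> \<in> EL5_axioms" for \<chi>
    using that by (auto intro: mp_closure.base)
  \<comment> \<open>Distribution of box over implication takes two axioms: the first gives the
    distributed implication under an extra box, and reflection removes that box.\<close>
  have "\<^bold>\<box> (\<^bold>\<box> \<alpha> \<^bold>\<rightarrow> \<^bold>\<box> \<beta>) \<in> ?C"
    using ax[OF EL5_axioms.intros(4)] mp.IH(1) by (rule mp_closure.mp)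
  with ax[OF EL5_axioms.intros(3)] have "\<^bold>\<box> \<alpha> \<^bold>\<rightarrow> \<^bold>\<box> \<beta> \<in> ?C"
    by (rule mp_closure.mp)
  then show ?case using mp.IH(2) by (rule mp_closure.mp)
qed

theorem theorem6p1:
  fixes \<Phi> :: "'v fm set" and \<phi> :: "'v fm"
  assumes "infinite (UNIV :: 'v set)"
    and "\<Phi> \<union> {\<phi>} \<subseteq> Fm_e"
  shows "\<Phi> \<turnstile>\<^sub>I\<^sub>E\<^sub>L \<phi> \<longleftrightarrow> Box ` \<Phi> \<turnstile>\<^sub>E\<^sub>L\<^sub>5 \<^bold>\<box> \<phi>"
proof
  assume "\<Phi> \<turnstile>\<^sub>I\<^sub>E\<^sub>L \<phi>"
  then show "Box ` \<Phi> \<turnstile>\<^sub>E\<^sub>L\<^sub>5 \<^bold>\<box> \<phi>" by (rule IEL_derives_imp_EL5_derives_Box)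
next
  assume box: "Box ` \<Phi> \<turnstile>\<^sub>E\<^sub>L\<^sub>5 \<^bold>\<box> \<phi>"
  have Fm: "\<Phi> \<subseteq> Fm_e" "\<phi> \<in> Fm_e" using assms(2) by auto
  show "\<Phi> \<turnstile>\<^sub>I\<^sub>E\<^sub>L \<phi>"
  proof (rule ccontr)
    assume "\<not> \<Phi> \<turnstile>\<^sub>I\<^sub>E\<^sub>L \<phi>"
    then obtain \<Gamma> where "prime_IEL_theory \<Gamma>" and \<Gamma>: "\<Phi> \<subseteq> \<Gamma>" "\<phi> \<notin> \<Gamma>"
      using prime_extension[OF assms(1) Fm] by blast
    then interpret prime_IEL_theory \<Gamma> by simp
    have "box_eval \<Gamma> \<phi> \<in> \<Gamma>"
      using box
    proof (rule EL5_derives_Box_mem)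
      fix \<psi>
      assume "\<psi> \<in> Box ` \<Phi>"
      then obtain \<alpha> where \<alpha>: "\<alpha> \<in> \<Phi>" "\<psi> = \<^bold>\<box> \<alpha>" by blast
      \<comment> \<open>Premises in \<Phi> are box-free and so unchanged by evaluation; lying in
        \<Gamma>, they make their boxes evaluate to verum.\<close>
      then have "box_eval \<Gamma> \<alpha> = \<alpha>" using Fm(1) by (intro box_eval_box_free) blast
      then have "box_eval \<Gamma> \<alpha> \<in> \<Gamma>" using \<alpha>(1) \<Gamma>(1) by auto
      then show "box_eval \<Gamma> \<psi> \<in> \<Gamma>" unfolding \<alpha>(2) box_eval_Box_mem_iff .
    qed
    then show False using \<Gamma>(2) Fm(2) by (simp add: box_eval_box_free)
  qed
qed

end
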